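(* Let $n\ge1$ and let $\mathfrak{g}_{p,B}$ and $\mathfrak{g}_{\tilde p,\tilde B}$ be two normalized Lie algebras (of the same $n$). Then $\mathfrak{g}_{p,B}$ and $\mathfrak{g}_{\tilde p,\tilde B}$ are isomorphic as Lie algebras if and only if both of the following hold: 1. $p=\tilde p$; and 2. there exists $S\in Sp(n,\mathbb{R})$ such that, after replacing the matrices $\tilde M_1,\tilde M_2$ with a suitable basis of $V_{\tilde M}=\mathrm{span}(\tilde M_1,\tilde M_2)$ (and correspondingly replacing $\tilde p_k$, $\tilde B_k$ and $\tilde C_k$), $$\tilde C_k=S\,C_k\,S^{-1}\qquad(k=1,2).$$
   Context: Given $p=(p_1,p_2)\in\mathbb{R}^2$ and a pair $B=(B_1,B_2)$ of commuting real $n\times n$ matrices, put $M_k=\mathrm{diag}(p_k,B_k,0)\in M_{n+2}(\mathbb{R})$ (block sizes $1,n,1$), $k=1,2$. It is assumed throughout that $M_1,M_2$ are linearly independent. $\mathfrak{g}_{p,B}$ is the $(2n+3)$-dimensional real Lie subalgebra of $M_{n+2}(\mathbb{R})$ (commutator bracket) $$\mathfrak{g}_{p,B}=V_M\oplus V_X\oplus V_Y\oplus V_Z,\qquad V_M=\mathrm{span}(M_1,M_2),$$ where $V_X=\{X_x:x\in\mathbb{R}^n\}$, $V_Y=\{Y_y:y\in\mathbb{R}^n\}$, $V_Z=\{Z_z:z\in\mathbb{R}\}$ and $$X_x=\begin{bmatrix}0&0&0\\ 0&0&x\\ 0&0&0\end{bmatrix},\quad Y_y=\begin{bmatrix}0&y^T&0\\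 0&0&0\\ 0&0&0\end{bmatrix},\quad Z_z=\begin{bmatrix}0&0&z\\ 0&0&0\\ 0&0&0\end{bmatrix}.$$ The Lie algebra $\mathfrak{g}_{p,B}$ is called normalized if $p_1\in\{0,1\}$ and $p_2=0$. Set $$C_k=\begin{bmatrix}B_k&0\\ 0&p_kI_n-B_k^T\end{bmatrix}\in M_{2n}(\mathbb{R}),\qquad k=1,2.$$ The tilded objects $\tilde M_k$, $\tilde C_k$, $V_{\tilde M}$ are defined in the same way from $(\tilde p,\tilde B)$. "Replacing $\tilde M_1,\tilde M_2$ with a basis of $V_{\tilde M}$" means: choosing another basis $\tilde M_k'=\mathrm{diag}(\tilde p_k',\tilde B_k',0)$ of $V_{\tilde M}$ and forming $\tilde C_k$ from $(\tilde p_k',\tilde B_k')$. $Sp(n,\mathbb{R})=\{S\in GL_{2n}(\mathbb{R}): S^T\mathcal{J}S=\mathcal{J}\}$ with $\mathcal{J}=\begin{bmatrix}0&-I_n\\ I_n&0\end{bmatrix}$. *)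

theory Defs
  imports "HOL-Analysis.Analysis"
begin

section \<open>Lie subalgebras of matrix algebras\<close>

definition commutator :: "real^'i^'i \<Rightarrow> real^'i^'i \<Rightarrow> real^'i^'i" where
  "commutator A B = A ** B - B ** A"

definition lie_subalgebra :: "(real^'i^'i) set \<Rightarrow> bool" where
  "lie_subalgebra L \<longleftrightarrow> subspace L \<and> (\<forall>A\<in>L. \<forall>B\<in>L. commutator A B \<in> L)"

text \<open>A homomorphism is only constrained on its domain \<^term>\<open>L\<close>.\<close>

definition lie_isomorphism ::
  "(real^'i^'i) set \<Rightarrow> (real^'j^'j) set \<Rightarrow> (real^'i^'i \<Rightarrow> real^'j^'j) \<Rightarrow> bool" where
  "lie_isomorphism L L' f \<longleftrightarrow> bij_betw f L L' \<and>
     (\<forall>A\<in>L. \<forall>B\<in>L. f (A + B) = f A + f B) \<and>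
     (\<forall>c. \<forall>A\<in>L. f (c *\<^sub>R A) = c *\<^sub>R f A) \<and>
     (\<forall>A\<in>L. \<forall>B\<in>L. f (commutator A B) = commutator (f A) (f B))"

definition lie_isomorphic :: "(real^'i^'i) set \<Rightarrow> (real^'j^'j) set \<Rightarrow> bool" where
  "lie_isomorphic L L' \<longleftrightarrow> (\<exists>f. lie_isomorphism L L' f)"


section \<open>The Lie algebras\<close>

text \<open>
  Matrices of size \<open>n + 2\<close> with block sizes \<open>1, n, 1\<close> are indexed by the type
  \<open>unit + 'n + unit\<close>. The following is the block matrix with rows
  \<open>(a, y\<^sup>T, z)\<close>, \<open>(0, A, x)\<close>, \<open>(0, 0, 0)\<close>.
\<close>

definition blk :: "real \<Rightarrow> real^'n^'n \<Rightarrow> real^'n \<Rightarrow> real^'n \<Rightarrow> real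
    \<Rightarrow> real^(unit + 'n + unit)^(unit + 'n + unit)" where
  "blk a A x y z = (\<chi> i j. case i of
       Inl _ \<Rightarrow> (case j of Inl _ \<Rightarrow> a | Inr (Inl l) \<Rightarrow> y $ l | Inr (Inr _) \<Rightarrow> z)
     | Inr (Inl k) \<Rightarrow> (case j of Inl _ \<Rightarrow> 0 | Inr (Inl l) \<Rightarrow> A $ k $ l | Inr (Inr _) \<Rightarrow> x $ k)
     | Inr (Inr _) \<Rightarrow> 0)"

text \<open>The indices \<open>k = 1, 2\<close> are the two elements of the type \<^typ>\<open>2\<close>.\<close>

definition M_mat :: "real^2 \<Rightarrow> real^'n^'n^2 \<Rightarrow> 2
    \<Rightarrow> real^(unit + 'n + unit)^(unit + 'n + unit)" where
  "M_mat p B k = blk (p $ k) (B $ k) 0 0 0"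

definition X_mat :: "real^'n \<Rightarrow> real^(unit + 'n + unit)^(unit + 'n + unit)" where
  "X_mat x = blk 0 0 x 0 0"

definition Y_mat :: "real^'n \<Rightarrow> real^(unit + 'n + unit)^(unit + 'n + unit)" where
  "Y_mat y = blk 0 0 0 y 0"

definition Z_mat :: "real \<Rightarrow> real^(unit + 'n::finite + unit)^(unit + 'n + unit)" where
  "Z_mat z = blk 0 0 0 0 z"

definition V_M :: "real^2 \<Rightarrow> real^'n^'n^2
    \<Rightarrow> (real^(unit + 'n + unit)^(unit + 'n + unit)) set" where
  "V_M p B = span (range (M_mat p B))"

text \<open>The injectivity clause excludes \<open>M\<^sub>1 = M\<^sub>2 \<noteq> 0\<close>, for which the set of values would
  be independent although the family is not.\<close>

definition M_independent :: "real^2 \<Rightarrow> real^'n^'n^2 \<Rightarrow> bool" where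
  "M_independent p B \<longleftrightarrow> inj (M_mat p B) \<and> independent (range (M_mat p B))"

definition admissible :: "real^2 \<Rightarrow> real^'n^'n^2 \<Rightarrow> bool" where
  "admissible p B \<longleftrightarrow> B $ 1 ** B $ 2 = B $ 2 ** B $ 1 \<and> M_independent p B"

definition g_alg :: "real^2 \<Rightarrow> real^'n^'n^2
    \<Rightarrow> (real^(unit + 'n + unit)^(unit + 'n + unit)) set" where
  "g_alg p B = {M + X_mat x + Y_mat y + Z_mat z | M x y z. M \<in> V_M p B}"

definition normalized :: "real^2 \<Rightarrow> bool" where
  "normalized p \<longleftrightarrow> p $ 1 \<in> {0, 1} \<and> p $ 2 = 0"

text \<open>A basis \<open>M'\<^sub>1, M'\<^sub>2\<close> of \<open>V\<^sub>M\<close>, presented by its block data \<open>(p', B')\<close>; every element of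
  \<open>V\<^sub>M\<close> has the form \<open>diag(a, A, 0)\<close> for unique \<open>a, A\<close>.\<close>

definition basis_of_V_M :: "real^2 \<Rightarrow> real^'n^'n^2 \<Rightarrow> real^2 \<Rightarrow> real^'n^'n^2 \<Rightarrow> bool" where
  "basis_of_V_M p B p' B' \<longleftrightarrow>
     M_independent p' B' \<and> span (range (M_mat p' B')) = V_M p B"


section \<open>Symplectic matrices and the matrices \<open>C\<^sub>k\<close>\<close>

definition block2 :: "real^'n^'n \<Rightarrow> real^'n^'n \<Rightarrow> real^'n^'n \<Rightarrow> real^'n^'n
    \<Rightarrow> real^('n + 'n)^('n + 'n)" where
  "block2 P Q R T = (\<chi> i j. case i of
       Inl k \<Rightarrow> (case j of Inl l \<Rightarrow> P $ k $ l | Inr l \<Rightarrow> Q $ k $ l)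
     | Inr k \<Rightarrow> (case j of Inl l \<Rightarrow> R $ k $ l | Inr l \<Rightarrow> T $ k $ l))"

definition C_mat :: "real^2 \<Rightarrow> real^'n^'n^2 \<Rightarrow> 2 \<Rightarrow> real^('n + 'n)^('n + 'n)" where
  "C_mat p B k = block2 (B $ k) 0 0 (p $ k *\<^sub>R mat 1 - transpose (B $ k))"

definition J_mat :: "real^('n::finite + 'n)^('n + 'n)" where
  "J_mat = block2 0 (- mat 1) (mat 1) 0"

definition Sp :: "(real^('n::finite + 'n)^('n + 'n)) set" where
  "Sp = {S. invertible S \<and> transpose S ** J_mat ** S = J_mat}"


section \<open>Sanity checks\<close>

lemma blk_eq_iff:
  "blk a A x y z = blk a' A' x' y' z' \<longleftrightarrow> a = a' \<and> A = A' \<and> x = x' \<and> y = y' \<and> z = z'"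
proof
  assume h: "blk a A x y z = blk a' A' x' y' z'"
  have e: "blk a A x y z $ i $ j = blk a' A' x' y' z' $ i $ j" for i j by (simp add: h)
  show "a = a' \<and> A = A' \<and> x = x' \<and> y = y' \<and> z = z'"
    using e[of "Inl ()" "Inl ()"] e[of "Inr (Inl _)" "Inr (Inl _)"]
      e[of "Inr (Inl _)" "Inr (Inr ())"] e[of "Inl ()" "Inr (Inl _)"] e[of "Inl ()" "Inr (Inr ())"]
    by (simp add: blk_def vec_eq_iff)
qed simp

lemma blk_add:
  "blk a A x y z + blk a' A' x' y' z' = blk (a + a') (A + A') (x + x') (y + y') (z + z')"
  by (auto simp: blk_def vec_eq_iff split: sum.splits)

lemma blk_diff:
  "blk a A x y z - blk a' A' x' y' z' = blk (a - a') (A - A') (x - x') (y - y') (z - z')"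
  by (auto simp: blk_def vec_eq_iff split: sum.splits)

lemma blk_scaleR: "c *\<^sub>R blk a A x y z = blk (c * a) (c *\<^sub>R A) (c *\<^sub>R x) (c *\<^sub>R y) (c * z)"
  by (auto simp: blk_def vec_eq_iff split: sum.splits)

lemma blk_zero: "blk 0 0 0 0 0 = 0"
  by (auto simp: blk_def vec_eq_iff split: sum.splits)

lemma sum_UNIV_Plus:
  fixes f :: "'a::finite + 'b::finite \<Rightarrow> 'c::comm_monoid_add"
  shows "(\<Sum>i\<in>UNIV. f i) = (\<Sum>i\<in>UNIV. f (Inl i)) + (\<Sum>i\<in>UNIV. f (Inr i))"
  by (simp add: UNIV_Plus_UNIV[symmetric] sum.Plus del: UNIV_Plus_UNIV)

lemma blk_mult:
  "blk a A x y z ** blk a' A' x' y' z'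
   = blk (a * a') (A ** A') (A *v x') (a *\<^sub>R y' + transpose A' *v y) (a * z' + y \<bullet> x')"
  by (auto simp: blk_def vec_eq_iff matrix_matrix_mult_def matrix_vector_mult_def inner_vec_def
      sum_UNIV_Plus transpose_def mult.commute UNIV_unit split: sum.splits)


lemma V_M_eq:
  "V_M p B = {blk (c * p $ 1 + d * p $ 2) (c *\<^sub>R B $ 1 + d *\<^sub>R B $ 2) 0 0 0 | c d. True}"
proof -
  have "range (M_mat p B) = {M_mat p B 1, M_mat p B 2}"
    by (simp add: UNIV_2)
  then show ?thesis
    by (auto simp: V_M_def span_insert span_singleton M_mat_def blk_scaleR blk_add blk_diff
        blk_eq_iff algebra_simps)
qed

definition g_elem :: "real^2 \<Rightarrow> real^'n^'n^2 \<Rightarrow> real \<times> real \<times> (real^'n) \<times> (real^'n) \<times> real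
    \<Rightarrow> real^(unit + 'n + unit)^(unit + 'n + unit)" where
  "g_elem p B = (\<lambda>(c, d, x, y, z).
     blk (c * p $ 1 + d * p $ 2) (c *\<^sub>R B $ 1 + d *\<^sub>R B $ 2) x y z)"

lemma g_alg_eq: "g_alg p B = range (g_elem p B)"
proof -
  have e: "blk a A 0 0 0 + X_mat x + Y_mat y + Z_mat z = blk a A x y z" for a A x y z
    by (simp add: X_mat_def Y_mat_def Z_mat_def blk_add)
  show ?thesis
  proof (intro subset_antisym subsetI)
    fix W assume "W \<in> g_alg p B"
    then obtain c d x y z where "W = g_elem p B (c, d, x, y, z)"
      by (auto simp: g_alg_def V_M_eq e g_elem_def)
    then show "W \<in> range (g_elem p B)" by simp
  next
    fix W assume "W \<in> range (g_elem p B)"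
    then obtain c d x y z where "W = g_elem p B (c, d, x, y, z)" by auto
    then have "W = blk (c * p $ 1 + d * p $ 2) (c *\<^sub>R B $ 1 + d *\<^sub>R B $ 2) 0 0 0
        + X_mat x + Y_mat y + Z_mat z"
      by (simp add: g_elem_def e)
    then show "W \<in> g_alg p B"
      unfolding g_alg_def V_M_eq by blast
  qed
qed

lemma linear_g_elem: "linear (g_elem p B)"
  by (auto intro!: linearI simp: g_elem_def blk_add blk_scaleR blk_eq_iff algebra_simps)

lemma matrix_linear_simps:
  fixes P Q R :: "real^'n^'n"
  shows "(P + Q) ** R = P ** R + Q ** R" "R ** (P + Q) = R ** P + R ** Q"
    "(c *\<^sub>R P) ** R = c *\<^sub>R (P ** R)" "R ** (c *\<^sub>R P) = c *\<^sub>R (R ** P)"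
  by (simp_all add: matrix_matrix_mult_def vec_eq_iff sum.distrib sum_distrib_left algebra_simps)

lemma g_alg_lie_subalgebra:
  assumes "B $ 1 ** B $ 2 = B $ 2 ** B $ 1"
  shows "lie_subalgebra (g_alg p B)"
proof -
  have "commutator (g_elem p B u) (g_elem p B v) \<in> range (g_elem p B)" for u v
  proof -
    obtain c d x y z where u: "u = (c, d, x, y, z)" by (cases u)
    obtain c' d' x' y' z' where v: "v = (c', d', x', y', z')" by (cases v)
    have comm: "(c *\<^sub>R B $ 1 + d *\<^sub>R B $ 2) ** (c' *\<^sub>R B $ 1 + d' *\<^sub>R B $ 2)
        = (c' *\<^sub>R B $ 1 + d' *\<^sub>R B $ 2) ** (c *\<^sub>R B $ 1 + d *\<^sub>R B $ 2)"
      by (simp add: matrix_linear_simps assms algebra_simps)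
    have "\<exists>x'' y'' z''. commutator (g_elem p B u) (g_elem p B v) = g_elem p B (0, 0, x'', y'', z'')"
      by (simp add: u v g_elem_def commutator_def blk_mult blk_diff blk_eq_iff comm)
    then show ?thesis by auto
  qed
  moreover have "subspace (range (g_elem p B))"
    by (simp add: linear_g_elem linear_subspace_image)
  ultimately show ?thesis
    by (auto simp: lie_subalgebra_def g_alg_eq)
qed

lemma dim_g_alg:
  fixes B :: "real^'n^'n^2"
  assumes "M_independent p B"
  shows "dim (g_alg p B) = 2 * CARD('n) + 3"
proof -
  have ne: "M_mat p B 1 \<noteq> M_mat p B 2"
    using assms by (auto simp: M_independent_def dest: injD)
  have r: "range (M_mat p B) = {M_mat p B 1, M_mat p B 2}"
    by (simp add: UNIV_2)
  have cd: "c = 0 \<and> d = 0" if "c *\<^sub>R M_mat p B 1 + d *\<^sub>R M_mat p B 2 = 0" for c d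
  proof (rule ccontr)
    assume "\<not> (c = 0 \<and> d = 0)"
    then have "dependent (range (M_mat p B))"
      unfolding r using ne that
      by (subst dependent_finite)
        (auto intro!: exI[of _ "\<lambda>m. if m = M_mat p B 1 then c else d"])
    then show False using assms by (simp add: M_independent_def)
  qed
  have "inj (g_elem p B)"
  proof (subst linear_injective_0[OF linear_g_elem], intro allI impI)
    fix u assume h: "g_elem p B u = 0"
    obtain c d x y z where u: "u = (c, d, x, y, z)" by (cases u)
    show "u = 0"
      using h cd[of c d]
      by (simp add: u g_elem_def M_mat_def blk_add blk_scaleR blk_eq_iff flip: blk_zero zero_prod_def)
  qed
  then have "dim (range (g_elem p B)) = DIM(real \<times> real \<times> (real^'n) \<times> (real^'n) \<times> real)"
    by (subst dim_image_eq) (auto simp: linear_g_elem inj_on_subset)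
  then show ?thesis by (simp add: g_alg_eq)
qed

end

theory Submission imports Defs
begin

text \<open>
  Write \<open>C(s) = s\<^sub>1 C\<^sub>1 + s\<^sub>2 C\<^sub>2\<close> and \<open>B(s) = s\<^sub>1 B\<^sub>1 + s\<^sub>2 B\<^sub>2\<close>. In the coordinates
  \<open>(s, w, z)\<close>, where \<open>s\<close> lists the coefficients of \<open>M\<^sub>1, M\<^sub>2\<close> and \<open>w = (x, y)\<close>, the algebra
  becomes the space \<open>\<real>\<^sup>2 \<times> \<real>\<^sup>2\<^sup>n \<times> \<real>\<close> with the bracket
  \<open>[(s, w, z), (s', w', z')] = (0, C(s) w' - C(s') w, (p \<bullet> s) z' - (p \<bullet> s') z + \<omega>(w, w'))\<close>,
  where \<open>\<omega>\<close> is the symplectic form with matrix \<open>J\<close>. Thus the elements with \<open>s = 0\<close> form a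
  Heisenberg ideal \<open>H\<close> with centre \<open>V\<^sub>Z\<close>, on which \<open>\<real>\<^sup>2\<close> acts by conformal symplectic maps:
  \<open>\<omega>(C(s) v, w) + \<omega>(v, C(s) w) = (p \<bullet> s) \<omega>(v, w)\<close>.

  If \<open>S\<close> is symplectic and conjugates \<open>C\<close> into \<open>C\<close>-tilde along a change of basis \<open>T\<close> of \<open>\<real>\<^sup>2\<close>,
  the conformal factors agree and \<open>(s, w, z) \<mapsto> (T s, S w, z)\<close> is an isomorphism. Conversely,
  an isomorphism that maps \<open>H\<close> to \<open>H\<close> induces linear maps \<open>T\<close> on \<open>\<real>\<^sup>2\<close> and \<open>S\<close> on \<open>\<real>\<^sup>2\<^sup>n\<close> and a
  factor \<open>c \<noteq> 0\<close> on the centre. They satisfy \<open>\<omega>(S v, S w) = c \<omega>(v, w)\<close>, \<open>S\<close> intertwines \<open>C(s)\<close>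
  with the tilded \<open>C(T s)\<close>, and \<open>p \<bullet> s\<close> is the tilded \<open>p \<bullet> T s\<close>, which for normalized weights
  forces them to be equal. Dividing \<open>S\<close> by \<open>\<surd>\<bar>c\<bar>\<close>, after composition with \<open>diag(I, -I)\<close> if
  \<open>c < 0\<close>, gives a symplectic matrix; \<open>diag(I, -I)\<close> reverses the sign of \<open>\<omega>\<close> and commutes with
  every \<open>C(s)\<close>.

  The main point is that every isomorphism respects \<open>H\<close> (\<open>heis_iso_preserves_ideal\<close>).
  This is not automatic, since \<open>H\<close> may be smaller than the nilradical. Let \<open>I\<close> be
  the image of \<open>H\<close>: an ideal of codimension 2 that contains the derived algebra and whose
  own brackets lie on a line \<open>\<real>\<zeta>\<close> central in \<open>I\<close>. Suppose that \<open>I\<close> contains elements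
  with \<open>s \<noteq> 0\<close>. Then for each \<open>(s, w, z)\<close> in \<open>I\<close> we have \<open>p \<bullet> s = 0\<close>, and the image of \<open>C(s)\<close>
  is \<open>\<omega>\<close>-orthogonal to \<open>U = {w. (0, w, 0) \<in> I}\<close>, a subspace of codimension at most 2. As \<open>B(s) \<noteq> 0\<close>
  by independence, the image of \<open>C(s)\<close> contains independent vectors \<open>(a, 0)\<close> and \<open>(0, b)\<close>. Hence
  \<open>U\<close> has codimension exactly 2, so \<open>I\<close> projects onto \<open>\<real>\<^sup>2\<close>, and all \<open>B(t)\<close> have image
  in \<open>\<real>a\<close> and all transposes have image in \<open>\<real>b\<close>. So \<open>B(t)\<close> ranges in the line spanned by
  \<open>a b\<^sup>T\<close> and vanishes for some \<open>t \<noteq> 0\<close>, although \<open>p \<bullet> t = 0\<close>; this contradicts independence.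
\<close>


section \<open>The symplectic form on pairs of vectors\<close>

text \<open>The components \<open>x\<close>, \<open>y\<close> of a vector \<open>w = (x, y)\<close> in \<open>\<real>\<^sup>2\<^sup>n\<close>, and the vector with given
  components.\<close>

definition xpart :: "real^('n::finite + 'n) \<Rightarrow> real^'n" where
  "xpart w = (\<chi> i. w $ Inl i)"

definition ypart :: "real^('n::finite + 'n) \<Rightarrow> real^'n" where
  "ypart w = (\<chi> i. w $ Inr i)"

definition join :: "real^'n \<Rightarrow> real^'n \<Rightarrow> real^('n::finite + 'n)" where
  "join x y = (\<chi> i. case i of Inl k \<Rightarrow> x $ k | Inr k \<Rightarrow> y $ k)"

lemma xpart_join [simp]: "xpart (join x y) = x"
  and ypart_join [simp]: "ypart (join x y) = y"
  by (simp_all add: xpart_def ypart_def join_def vec_eq_iff)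

lemma join_parts [simp]: "join (xpart w) (ypart w) = w"
  by (auto simp: xpart_def ypart_def join_def vec_eq_iff split: sum.splits)

lemma xpart_linear [simp]:
  "xpart (v + w) = xpart v + xpart w" "xpart (v - w) = xpart v - xpart w"
  "xpart (c *\<^sub>R w) = c *\<^sub>R xpart w" "xpart 0 = 0"
  by (simp_all add: xpart_def vec_eq_iff)

lemma ypart_linear [simp]:
  "ypart (v + w) = ypart v + ypart w" "ypart (v - w) = ypart v - ypart w"
  "ypart (c *\<^sub>R w) = c *\<^sub>R ypart w" "ypart 0 = 0"
  by (simp_all add: ypart_def vec_eq_iff)

lemma parts_eq_iff: "v = w \<longleftrightarrow> xpart v = xpart w \<and> ypart v = ypart w"
  by (metis join_parts)

lemma inner_parts: "v \<bullet> w = xpart v \<bullet> xpart w + ypart v \<bullet> ypart w"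
  by (simp add: inner_vec_def sum_UNIV_Plus xpart_def ypart_def)

lemma block2_mult_vec:
  "block2 P Q R T *v w = join (P *v xpart w + Q *v ypart w) (R *v xpart w + T *v ypart w)"
  by (auto simp: block2_def join_def xpart_def ypart_def matrix_vector_mult_def vec_eq_iff
      sum_UNIV_Plus split: sum.splits)

text \<open>The symplectic form with matrix \<open>J\<close>.\<close>

definition omega :: "real^('n::finite + 'n) \<Rightarrow> real^('n + 'n) \<Rightarrow> real" where
  "omega v w = v \<bullet> (J_mat *v w)"

lemma omega_parts:
  fixes v w :: "real^('n::finite + 'n)"
  shows "omega v w = ypart v \<bullet> xpart w - xpart v \<bullet> ypart w"
proof -
  have "(- mat 1) *v y = - y" for y :: "real^'n"
    using matrix_vector_mult_diff_rdistrib[of 0 "mat 1" y] by simp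
  then show ?thesis
    by (simp add: omega_def J_mat_def block2_mult_vec inner_parts)
qed

lemma omega_linear [simp]:
  "omega (u + v) w = omega u w + omega v w" "omega w (u + v) = omega w u + omega w v"
  "omega (u - v) w = omega u w - omega v w" "omega w (u - v) = omega w u - omega w v"
  "omega (c *\<^sub>R v) w = c * omega v w" "omega w (c *\<^sub>R v) = c * omega w v"
  "omega 0 w = 0" "omega w 0 = 0"
  by (simp_all add: omega_parts algebra_simps)

lemma omega_nondegenerate:
  assumes "\<And>w. omega v w = 0"
  shows "v = 0"
proof -
  have "omega v (join (ypart v) (- xpart v)) = ypart v \<bullet> ypart v + xpart v \<bullet> xpart v"
    by (simp add: omega_parts)
  with assms show ?thesis
    by (simp add: parts_eq_iff add_nonneg_eq_0_iff)
qed

lemma omega_unit: "\<exists>v w :: real^('n::finite + 'n). omega v w = 1"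
proof -
  obtain e :: "real^'n" where "e \<bullet> e = 1"
    by (metis inner_axis_axis real_inner_1_right axis_def inner_real_def mult_1)
  then have "omega (join 0 e) (join e 0) = 1"
    by (simp add: omega_parts)
  then show ?thesis by blast
qed

section \<open>The conformal symplectic operators\<close>

text \<open>The combination \<open>B(s) = s\<^sub>1 B\<^sub>1 + s\<^sub>2 B\<^sub>2\<close>.\<close>

definition comb :: "real^'n^'n^2 \<Rightarrow> real^2 \<Rightarrow> real^'n^'n" where
  "comb B s = s $ 1 *\<^sub>R B $ 1 + s $ 2 *\<^sub>R B $ 2"

lemma comb_linear [simp]:
  "comb B (s + t) = comb B s + comb B t" "comb B (s - t) = comb B s - comb B t"
  "comb B (c *\<^sub>R s) = c *\<^sub>R comb B s" "comb B 0 = 0"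
  by (simp_all add: comb_def algebra_simps)

lemma comb_axis [simp]: "comb B (axis k 1) = B $ k"
  using exhaust_2[of k] by (auto simp: comb_def axis_def)

lemma inner_axis_real [simp]: "p \<bullet> axis k (1::real) = p $ k"
  by (simp add: inner_axis)

lemma real2_eq_axes: "s = s $ 1 *\<^sub>R axis 1 1 + s $ 2 *\<^sub>R axis 2 1" for s :: "real^2"
  by (simp add: vec_eq_iff forall_2 axis_def)

lemma comb_commute:
  assumes "B $ 1 ** B $ 2 = B $ 2 ** B $ 1"
  shows "comb B s ** comb B t = comb B t ** comb B s"
  by (simp add: comb_def matrix_linear_simps assms algebra_simps)

text \<open>The operator \<open>C(s) = s\<^sub>1 C\<^sub>1 + s\<^sub>2 C\<^sub>2\<close> on \<open>\<real>\<^sup>2\<^sup>n\<close>, which is the adjoint action of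
  \<open>s\<^sub>1 M\<^sub>1 + s\<^sub>2 M\<^sub>2\<close> on \<open>V\<^sub>X \<oplus> V\<^sub>Y\<close>.\<close>

definition act :: "real^2 \<Rightarrow> real^'n^'n^2 \<Rightarrow> real^2 \<Rightarrow> real^('n::finite + 'n) \<Rightarrow> real^('n + 'n)" where
  "act p B s w = join (comb B s *v xpart w) ((p \<bullet> s) *\<^sub>R ypart w - transpose (comb B s) *v ypart w)"

lemma transpose_linear:
  "transpose (P + Q) = transpose P + transpose (Q :: real^'n^'m)"
  "transpose (P - Q) = transpose P - transpose Q"
  "transpose (c *\<^sub>R P) = c *\<^sub>R transpose P"
  "transpose (0 :: real^'n^'m) = 0"
  by (simp_all add: transpose_def vec_eq_iff)

lemmas mv_simps = matrix_vector_mult_add_rdistrib matrix_vector_mult_diff_rdistrib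
  matrix_vector_right_distrib matrix_vector_mult_diff_distrib scaleR_matrix_vector_assoc[symmetric]
  matrix_vector_mult_scaleR

lemma act_linear [simp]:
  "act p B s (v + w) = act p B s v + act p B s w"
  "act p B s (v - w) = act p B s v - act p B s w"
  "act p B s (c *\<^sub>R w) = c *\<^sub>R act p B s w"
  "act p B s 0 = 0"
  "act p B (s + t) w = act p B s w + act p B t w"
  "act p B (s - t) w = act p B s w - act p B t w"
  "act p B (c *\<^sub>R s) w = c *\<^sub>R act p B s w"
  "act p B 0 w = 0"
  unfolding parts_eq_iff
  by (simp_all add: act_def mv_simps transpose_linear inner_add_right inner_diff_right algebra_simps
     del: transpose_matrix_vector)

lemma inner_transpose_mult: "(transpose M *v y) \<bullet> x = y \<bullet> (M *v x)" for M :: "real^'n^'m"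
  by (metis dot_lmul_matrix transpose_matrix_vector)

lemma matrix_eq_0_iff: "M = 0 \<longleftrightarrow> (\<forall>v. M *v v = 0)" for M :: "real^'n^'m"
  by (simp add: matrix_eq)

lemma transpose_eq_0_iff: "transpose M = 0 \<longleftrightarrow> M = 0" for M :: "real^'n^'m"
  by (auto simp: transpose_def vec_eq_iff)

lemma C_mat_mult_vec: "C_mat p B k *v w = act p B (axis k 1) w"
  by (simp add: C_mat_def block2_mult_vec act_def mv_simps)

text \<open>Each \<open>C(s)\<close> is an infinitesimal symplectic similitude with factor \<open>p \<bullet> s\<close>.\<close>

lemma omega_act: "omega (act p B s v) w + omega v (act p B s w) = (p \<bullet> s) * omega v w"
proof -
  have "xpart v \<bullet> (transpose (comb B s) *v ypart w) = ypart w \<bullet> (comb B s *v xpart v)"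
    by (metis inner_commute inner_transpose_mult)
  then show ?thesis
    by (simp add: omega_parts act_def inner_diff_left inner_diff_right inner_transpose_mult
        right_diff_distrib inner_commute[of "ypart w"] del: transpose_matrix_vector)
qed

section \<open>Coordinates on the Lie algebra\<close>

text \<open>Coordinates \<open>(s, w, z)\<close>: the coefficients \<open>s\<close> of \<open>M\<^sub>1, M\<^sub>2\<close>, the vector \<open>w = (x, y)\<close> of
  the \<open>V\<^sub>X\<close> and \<open>V\<^sub>Y\<close> components, and the \<open>V\<^sub>Z\<close> component.\<close>

type_synonym 'n heis = "(real^2) \<times> (real^('n + 'n)) \<times> real"

text \<open>The Lie bracket in these coordinates.\<close>

definition br :: "real^2 \<Rightarrow> real^'n^'n^2 \<Rightarrow> ('n::finite) heis \<Rightarrow> 'n heis \<Rightarrow> 'n heis" where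
  "br p B = (\<lambda>(s, w, z) (s', w', z').
     (0, act p B s w' - act p B s' w, (p \<bullet> s) * z' - (p \<bullet> s') * z + omega w w'))"

text \<open>The matrix with given coordinates.\<close>

definition emb :: "real^2 \<Rightarrow> real^'n^'n^2 \<Rightarrow> ('n::finite) heis
    \<Rightarrow> real^(unit + 'n + unit)^(unit + 'n + unit)" where
  "emb p B = (\<lambda>(s, w, z). blk (p \<bullet> s) (comb B s) (xpart w) (ypart w) z)"

lemma range_emb: "range (emb p B) = g_alg p B"
proof -
  have 1: "g_elem p B (c, d, x, y, z) = emb p B (vector [c, d], join x y, z)" for c d x y z
    by (simp add: g_elem_def emb_def comb_def inner_vec_def sum_2 mult.commute)
  have 2: "emb p B (s, w, z) = g_elem p B (s $ 1, s $ 2, xpart w, ypart w, z)" for s w z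
    by (simp add: g_elem_def emb_def comb_def inner_vec_def sum_2 mult.commute)
  show ?thesis
    unfolding g_alg_eq
  proof (intro subset_antisym subsetI)
    fix W assume "W \<in> range (emb p B)"
    then obtain s w z where "W = emb p B (s, w, z)" by auto
    then show "W \<in> range (g_elem p B)" using 2 by auto
  next
    fix W assume "W \<in> range (g_elem p B)"
    then obtain c d x y z where "W = g_elem p B (c, d, x, y, z)" by auto
    then show "W \<in> range (emb p B)" using 1 by auto
  qed
qed

lemma linear_emb: "linear (emb p B)"
  by (rule linearI) (auto simp: emb_def blk_add blk_scaleR inner_add_right)

lemma commutator_emb:
  assumes "B $ 1 ** B $ 2 = B $ 2 ** B $ 1"
  shows "commutator (emb p B u) (emb p B v) = emb p B (br p B u v)"
  by (cases u; cases v)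
    (simp add: emb_def br_def act_def commutator_def blk_mult blk_diff blk_eq_iff
      comb_commute[OF assms] omega_parts algebra_simps inner_commute del: transpose_matrix_vector)

section \<open>Independence and bases of \<open>V\<^sub>M\<close>\<close>

text \<open>The coordinates on \<open>V\<^sub>M\<close> alone: \<open>s \<mapsto> s\<^sub>1 M\<^sub>1 + s\<^sub>2 M\<^sub>2\<close>.\<close>

definition embM :: "real^2 \<Rightarrow> real^'n^'n^2 \<Rightarrow> real^2
    \<Rightarrow> real^(unit + 'n::finite + unit)^(unit + 'n + unit)" where
  "embM p B s = blk (p \<bullet> s) (comb B s) 0 0 0"

lemma linear_embM: "linear (embM p B)"
  by (rule linearI) (auto simp: embM_def blk_add blk_scaleR inner_add_right)

lemma embM_axis: "embM p B (axis k 1) = M_mat p B k"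
  by (simp add: embM_def M_mat_def)

lemma range_embM: "range (embM p B) = V_M p B"
proof -
  have 1: "embM p B s = blk (s $ 1 * p $ 1 + s $ 2 * p $ 2)
      (s $ 1 *\<^sub>R B $ 1 + s $ 2 *\<^sub>R B $ 2) 0 0 0" for s
    by (simp add: embM_def comb_def inner_vec_def sum_2 mult.commute)
  have "\<exists>s :: real^2. s $ 1 = c \<and> s $ 2 = d" for c d
    by (rule exI[of _ "vector [c, d]"]) simp
  then show ?thesis
    unfolding V_M_eq 1 image_def by (auto; metis)
qed

lemma M_independent_iff: "M_independent p B \<longleftrightarrow> inj (embM p B)"
proof
  assume ind: "M_independent p B"
  then have ne: "M_mat p B 1 \<noteq> M_mat p B 2"
    by (auto simp: M_independent_def dest: injD)
  have r: "range (M_mat p B) = {M_mat p B 1, M_mat p B 2}"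
    by (simp add: UNIV_2)
  have e: "embM p B s = s $ 1 *\<^sub>R M_mat p B 1 + s $ 2 *\<^sub>R M_mat p B 2" for s
    by (simp add: embM_def M_mat_def blk_add blk_scaleR comb_def inner_vec_def sum_2 mult.commute)
  show "inj (embM p B)"
  proof (subst linear_injective_0[OF linear_embM], intro allI impI)
    fix s assume h: "embM p B s = 0"
    show "s = 0"
    proof (rule ccontr)
      assume "s \<noteq> 0"
      then have "s $ 1 \<noteq> 0 \<or> s $ 2 \<noteq> 0" by (simp add: vec_eq_iff forall_2)
      then have "dependent (range (M_mat p B))"
        unfolding r using ne h[unfolded e]
        by (subst dependent_finite)
          (auto intro!: exI[of _ "\<lambda>m. if m = M_mat p B 1 then s $ 1 else s $ 2"])
      then show False using ind by (simp add: M_independent_def)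
    qed
  qed
next
  assume inj: "inj (embM p B)"
  have r: "M_mat p B = embM p B \<circ> (\<lambda>k. axis k 1)"
    by (simp add: fun_eq_iff embM_axis)
  have "inj (\<lambda>k::2. axis k (1::real))"
    by (rule injI) (simp add: axis_eq_axis)
  then have "inj (M_mat p B)"
    unfolding r using inj by (simp add: inj_compose)
  moreover have "independent (range (\<lambda>k::2. axis k (1::real)))"
    by (rule independent_mono[OF independent_Basis]) (auto simp: Basis_vec_def)
  then have "independent (range (M_mat p B))"
    unfolding r image_comp[symmetric]
    by (rule linear_independent_injective_image[OF linear_embM _ inj_on_subset[OF inj]]) auto
  ultimately show "M_independent p B" by (simp add: M_independent_def)
qed

lemma inj_embM_iff: "inj (embM p B) \<longleftrightarrow> (\<forall>s. p \<bullet> s = 0 \<and> comb B s = 0 \<longrightarrow> s = 0)"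
  by (simp add: linear_injective_0[OF linear_embM] embM_def blk_eq_iff flip: blk_zero)

lemma inj_emb:
  assumes "M_independent p B"
  shows "inj (emb p B)"
proof (subst linear_injective_0[OF linear_emb], intro allI impI)
  fix u assume "emb p B u = 0"
  with assms show "u = 0"
    by (cases u) (auto simp: emb_def M_independent_iff inj_embM_iff blk_eq_iff parts_eq_iff zero_prod_def
        simp flip: blk_zero)
qed

text \<open>A basis of \<open>V\<^sub>M\<close> amounts to an invertible change of coordinates \<open>T\<close>, through which the
  new \<open>p\<close> and \<open>B\<close> are obtained from the old ones.\<close>

lemma basis_of_V_M_iff:
  assumes "M_independent p B"
  shows "basis_of_V_M p B p' B' \<longleftrightarrow> (\<exists>T. linear T \<and> inj T \<and>
    (\<forall>s. p' \<bullet> s = p \<bullet> T s \<and> comb B' s = comb B (T s)))"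
proof
  assume b: "basis_of_V_M p B p' B'"
  obtain g where g: "linear g" "g \<circ> embM p B = id"
    using assms linear_injective_left_inverse[OF linear_embM] by (auto simp: M_independent_iff)
  have inj': "inj (embM p' B')" and ran: "range (embM p' B') = range (embM p B)"
    using b by (auto simp: basis_of_V_M_def M_independent_iff range_embM V_M_def)
  have T: "embM p B (g (embM p' B' s)) = embM p' B' s" for s
  proof -
    obtain t where "embM p' B' s = embM p B t" using ran by blast
    then show ?thesis using g(2) by (simp add: fun_eq_iff)
  qed
  have "inj (g \<circ> embM p' B')"
    by (rule injI) (metis T inj' injD comp_apply)
  moreover have "linear (g \<circ> embM p' B')"
    by (rule linear_compose[OF linear_embM g(1)])
  ultimately show "\<exists>T. linear T \<and> inj T \<and> (\<forall>s. p' \<bullet> s = p \<bullet> T s \<and> comb B' s = comb B (T s))"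
    using T by (intro exI[of _ "g \<circ> embM p' B'"]) (auto simp: embM_def blk_eq_iff)
next
  assume "\<exists>T. linear T \<and> inj T \<and> (\<forall>s. p' \<bullet> s = p \<bullet> T s \<and> comb B' s = comb B (T s))"
  then obtain T :: "real^2 \<Rightarrow> real^2" where T: "linear T" "inj T"
    "embM p' B' = embM p B \<circ> T"
    by (auto simp: embM_def fun_eq_iff)
  have "surj T" using T by (simp add: linear_injective_imp_surjective)
  then have "range (embM p' B') = range (embM p B)"
    unfolding T(3) by (metis image_comp)
  moreover have "inj (embM p' B')"
    unfolding T(3) using assms T(2) by (simp add: M_independent_iff inj_compose)
  ultimately show "basis_of_V_M p B p' B'"
    by (simp add: basis_of_V_M_def M_independent_iff range_embM V_M_def)
qed

section \<open>Isomorphisms preserve the Heisenberg ideal\<close>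

lemma orthogonal_nullspace_imp_rowspace:
  fixes A :: "real^'n^'m"
  assumes "\<And>w. A *v w = 0 \<Longrightarrow> q \<bullet> w = 0"
  shows "q \<in> span (rows A)"
proof -
  obtain y z where y: "y \<in> span (rows A)" and z: "\<And>w. w \<in> span (rows A) \<Longrightarrow> orthogonal z w"
    and q: "q = y + z"
    using orthogonal_subspace_decomp_exists[of "rows A" q] by metis
  have "A *v z = 0"
  proof (rule vec_eq_iff[THEN iffD2], rule allI)
    fix i
    have "row i A \<in> span (rows A)"
      by (auto simp: rows_def intro: span_base)
    from z[OF this] show "(A *v z) $ i = 0 $ i"
      by (simp add: orthogonal_def matrix_vector_mul_component row_def vec_lambda_eta inner_commute)
  qed
  then have "q \<bullet> z = 0" by (rule assms)
  moreover have "y \<bullet> z = 0" using z[OF y] by (simp add: orthogonal_def inner_commute)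
  ultimately have "z = 0" by (simp add: q inner_add_left)
  with q y show ?thesis by simp
qed

lemma full_rank_two_rows:
  fixes A :: "real^'n^2"
  assumes q: "q1 \<in> span (rows A)" "q2 \<in> span (rows A)"
    and ind: "independent {q1, q2}" "q1 \<noteq> q2"
  shows "surj ((*v) A)" and "span (rows A) \<subseteq> span {q1, q2}"
proof -
  have le: "rank A \<le> 2"
    using rank_bound[of A] by simp
  have ge: "2 \<le> dim (span (rows A))"
    using independent_card_le_dim[of "{q1, q2}" "span (rows A)"] q ind by simp
  show "surj ((*v) A)"
    unfolding full_rank_surjective[symmetric] using le ge by (simp add: row_rank_def)
  show "span (rows A) \<subseteq> span {q1, q2}"
    using card_ge_dim_independent[of "{q1, q2}" "span (rows A)"] q ind le
    by (simp add: row_rank_def)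
qed

text \<open>A Lie algebra isomorphism, in coordinates.\<close>

definition heis_iso :: "real^2 \<Rightarrow> real^'n^'n^2 \<Rightarrow> real^2 \<Rightarrow> real^'n^'n^2
    \<Rightarrow> (('n::finite) heis \<Rightarrow> 'n heis) \<Rightarrow> bool" where
  "heis_iso p B p' B' F \<longleftrightarrow>
    linear F \<and> bij F \<and> (\<forall>u v. F (br p B u v) = br p' B' (F u) (F v))"

text \<open>Below, \<open>I\<close> is the image of the Heisenberg ideal and \<open>\<zeta>\<close> spans the image of its centre. A
  point of \<open>I\<close> outside the Heisenberg ideal of the target is shown to force the operators
  \<open>B(t)\<close> into a single line.\<close>

lemma heis_iso_preserves_ideal:
  fixes B B' :: "real^'n^'n^2"
  assumes iso: "heis_iso p' B' p B F" and ind: "M_independent p B" and u0: "fst u0 = 0"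
  shows "fst (F u0) = 0"
proof (rule ccontr)
  assume nz: "fst (F u0) \<noteq> 0"
  have lin: "linear F" and bij: "bij F" and hom: "\<And>u v. F (br p' B' u v) = br p B (F u) (F v)"
    using iso by (auto simp: heis_iso_def)
  define I where "I = F ` {u. fst u = 0}"
  define \<zeta> where "\<zeta> = F (0, 0, 1)"
  have sub: "subspace I"
    unfolding I_def by (intro linear_subspace_image[OF lin]) (auto simp: subspace_def)
  have br_fst: "fst (br q C u v) = 0" for q C and u v :: "'n heis"
    by (cases u; cases v) (simp add: br_def)
  have I_E: "\<exists>w z. u = F (0, w, z)" if "u \<in> I" for u
    using that unfolding I_def by (metis (mono_tags, lifting) image_iff mem_Collect_eq prod.collapse)
  have I_br: "\<exists>k. br p B u v = k *\<^sub>R \<zeta>" if uv: "u \<in> I" "v \<in> I" for u v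
  proof -
    obtain w z w' z' where u: "u = F (0, w, z)" and v: "v = F (0, w', z')"
      using I_E[OF uv(1)] I_E[OF uv(2)] by blast
    have "br p B u v = F (br p' B' (0, w, z) (0, w', z'))"
      by (simp add: u v hom)
    also have "br p' B' (0, w, z) (0, w', z') = omega w w' *\<^sub>R (0, 0, 1)"
      by (simp add: br_def)
    finally show ?thesis
      unfolding \<zeta>_def linear_cmul[OF lin] by blast
  qed
  have I_cent: "br p B u \<zeta> = 0" if uI: "u \<in> I" for u
  proof -
    obtain w z where u: "u = F (0, w, z)"
      using I_E[OF uI] by blast
    have "br p B u \<zeta> = F (br p' B' (0, w, z) (0, 0, 1))"
      by (simp add: u \<zeta>_def hom)
    also have "br p' B' (0, w, z) (0, 0, 1) = 0"
      by (simp add: br_def zero_prod_def)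
    finally show ?thesis by (simp add: linear_0[OF lin])
  qed
  have I_derived: "br p B u v \<in> I" for u v
  proof -
    obtain u' v' where "u = F u'" "v = F v'"
      using bij by (metis bij_pointE)
    then have "br p B u v = F (br p' B' u' v')" by (simp add: hom)
    then show ?thesis unfolding I_def using br_fst by blast
  qed
  have I_C: "(0, act p B s w, 0) \<in> I" for s w
    using I_derived[of "(s, 0, 0)" "(0, w, 0)"] by (simp add: br_def)
  have I_Z: "(0, 0, z) \<in> I" for z
  proof -
    obtain v w :: "real^('n + 'n)" where "omega v w = 1" using omega_unit by blast
    then show ?thesis
      using subspace_scale[OF sub I_derived[of "(0, v, 0)" "(0, w, 0)"], of z] by (simp add: br_def)
  qed
  have P0: "p \<bullet> s = 0" if m: "(s, w0, z0) \<in> I" for s w0 z0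
  proof (rule ccontr)
    assume ps: "p \<bullet> s \<noteq> 0"
    obtain k where "br p B (s, w0, z0) (0, 0, 1) = k *\<^sub>R \<zeta>"
      using I_br[OF m I_Z] by blast
    \<comment> \<open>So the centre of \<open>I\<close> would be \<open>V\<^sub>Z\<close>, on which \<open>(s, w0, z0)\<close> acts by \<open>p \<bullet> s \<noteq> 0\<close>.\<close>
    then have k: "k *\<^sub>R \<zeta> = (0, 0, p \<bullet> s)" by (simp add: br_def)
    have "br p B (s, w0, z0) (k *\<^sub>R \<zeta>) = k *\<^sub>R br p B (s, w0, z0) \<zeta>"
      by (cases \<zeta>) (simp add: br_def algebra_simps)
    then show False
      using ps I_cent[OF m] unfolding k by (simp add: br_def zero_prod_def)
  qed
  have P2: "omega (act p B s v) w = 0"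
    if m: "(s, w0, z0) \<in> I" and w: "(0, w, 0) \<in> I" for s w0 z0 v w
  proof (rule ccontr)
    assume om: "omega (act p B s v) w \<noteq> 0"
    obtain k where "br p B (0, act p B s v, 0) (0, w, 0) = k *\<^sub>R \<zeta>"
      using I_br[OF I_C w] by blast
    then have k: "k *\<^sub>R \<zeta> = (0, 0, omega (act p B s v) w)" by (simp add: br_def)
    obtain l where "br p B (s, w0, z0) (0, w, 0) = l *\<^sub>R \<zeta>"
      using I_br[OF m w] by blast
    then have l: "l *\<^sub>R \<zeta> = (0, act p B s w, omega w0 w)" by (simp add: br_def)
    \<comment> \<open>By \<open>k\<close>, \<open>\<zeta>\<close> lies in \<open>V\<^sub>Z\<close>; hence by \<open>l\<close> the operator \<open>C(s)\<close> kills \<open>w\<close>, which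
      contradicts the similitude identity because \<open>p \<bullet> s = 0\<close>.\<close>
    have "k \<noteq> 0" using k om by (auto simp: zero_prod_def)
    then have "fst (snd \<zeta>) = 0" using k by (cases \<zeta>) auto
    then have "act p B s w = 0" using l by (cases \<zeta>) auto
    then show False
      using omega_act[of p B s v w] P0[OF m] om by simp
  qed
  obtain G where G: "linear G" "\<And>u. G (F u) = u"
    using linear_injective_left_inverse[OF lin bij_is_inj[OF bij]] by (auto simp: fun_eq_iff)
  have I_iff: "u \<in> I \<longleftrightarrow> fst (G u) = 0" for u
    using bij G(2) unfolding I_def by (metis (mono_tags, lifting) bij_pointE image_iff mem_Collect_eq)
  \<comment> \<open>The null space of \<open>A\<close> is \<open>{w. (0, w, 0) \<in> I}\<close>; it has codimension at most 2 because \<open>A\<close>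
    has two rows.\<close>
  define A where "A = matrix (\<lambda>w. fst (G (0, w, 0)))"
  have "linear (\<lambda>w. fst (G (0, w, 0)))"
  proof (rule linearI)
    show "fst (G (0, v + w, 0)) = fst (G (0, v, 0)) + fst (G (0, w, 0))" for v w
      using linear_add[OF G(1), of "(0, v, 0)" "(0, w, 0)"] by simp
    show "fst (G (0, c *\<^sub>R w, 0)) = c *\<^sub>R fst (G (0, w, 0))" for c w
      using linear_cmul[OF G(1), of c "(0, w, 0)"] by simp
  qed
  then have A: "A *v w = fst (G (0, w, 0))" for w
    unfolding A_def by (simp add: matrix_works)
  \<comment> \<open>\<open>\<omega>\<close>-orthogonality to \<open>(x, y)\<close> is Euclidean orthogonality to \<open>(y, -x)\<close>, so the vectors
    \<open>(B(t) v, 0)\<close> and \<open>(0, -B(t)\<^sup>T v)\<close> in the image of \<open>C(t)\<close> appear rotated, up to sign.\<close>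
  have rows1: "join 0 (comb B t *v v) \<in> span (rows A)"
    and rows2: "join (transpose (comb B t) *v v) 0 \<in> span (rows A)"
    if t: "(t, w0, z0) \<in> I" for t w0 z0 v
  proof -
    have om: "omega (act p B t v') w = 0" if "A *v w = 0" for v' w
      using P2[OF t] that by (simp add: A I_iff)
    show "join 0 (comb B t *v v) \<in> span (rows A)"
      using om[of _ "join v 0"]
      by (intro orthogonal_nullspace_imp_rowspace) (simp add: omega_parts act_def inner_parts)
    show "join (transpose (comb B t) *v v) 0 \<in> span (rows A)"
      using om[of _ "join 0 v"] P0[OF t]
      by (intro orthogonal_nullspace_imp_rowspace)
        (simp add: omega_parts act_def inner_parts del: transpose_matrix_vector)
  qed
  obtain s w0 z0 where s: "F u0 = (s, w0, z0)" by (cases "F u0")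
  have sI: "(s, w0, z0) \<in> I" unfolding s[symmetric] I_def using u0 by blast
  have "s \<noteq> 0" using nz s by simp
  then have Bs: "comb B s \<noteq> 0"
    using ind P0[OF sI] unfolding M_independent_iff inj_embM_iff by blast
  then obtain v1 where v1: "comb B s *v v1 \<noteq> 0"
    unfolding matrix_eq_0_iff by blast
  define a where "a = comb B s *v v1"
  have "transpose (comb B s) \<noteq> 0"
    using Bs by (simp add: transpose_eq_0_iff)
  then obtain v2 where v2: "transpose (comb B s) *v v2 \<noteq> 0"
    unfolding matrix_eq_0_iff by blast
  define b where "b = transpose (comb B s) *v v2"
  have ab: "a \<noteq> 0" "b \<noteq> 0" using v1 v2 by (simp_all add: a_def b_def)
  have q: "join 0 a \<in> span (rows A)" "join b 0 \<in> span (rows A)"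
    unfolding a_def b_def by (rule rows1[OF sI], rule rows2[OF sI])
  have ne: "join 0 a \<noteq> join b 0" using ab by (auto simp: parts_eq_iff)
  have indq: "independent {join 0 a, join b 0}"
    using ab by (auto simp: independent_insert span_singleton parts_eq_iff)
  note full = full_rank_two_rows[OF q indq ne]
  \<comment> \<open>As \<open>A\<close> is onto, \<open>I\<close> projects onto \<open>\<real>\<^sup>2\<close>.\<close>
  have all: "\<exists>w. (t, w, 0) \<in> I" for t
  proof -
    obtain w where "A *v w = - fst (G (t, 0, 0))"
      using full(1) by (metis surjD)
    then have "fst (G (t, w, 0)) = 0"
      using linear_add[OF G(1), of "(t, 0, 0)" "(0, w, 0)"] by (simp add: A)
    then show ?thesis using I_iff by blast
  qed
  have span_a: "\<exists>k. comb B t *v v = k *\<^sub>R a" and span_b: "\<exists>k. transpose (comb B t) *v v = k *\<^sub>R b" for t v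
  proof -
    obtain w where t: "(t, w, 0) \<in> I" using all by blast
    have "join 0 (comb B t *v v) \<in> span {join 0 a, join b 0}"
      using rows1[OF t] full(2) by blast
    then show "\<exists>k. comb B t *v v = k *\<^sub>R a"
      by (auto simp: span_insert span_singleton parts_eq_iff)
    have "join (transpose (comb B t) *v v) 0 \<in> span {join 0 a, join b 0}"
      using rows2[OF t] full(2) by blast
    then show "\<exists>k. transpose (comb B t) *v v = k *\<^sub>R b"
      by (auto simp: span_insert span_singleton parts_eq_iff)
  qed
  \<comment> \<open>One linear condition on \<open>\<real>\<^sup>2\<close>. As \<open>B(t) b\<close> is a multiple of \<open>a\<close>, it makes \<open>B(t) b\<close>, and
    then \<open>B(t)\<close>, vanish.\<close>
  obtain t :: "real^2" where t: "t \<noteq> 0" "a \<bullet> (comb B t *v b) = 0"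
  proof (cases "a \<bullet> (B $ 1 *v b) = 0")
    case True
    have "axis 1 1 \<noteq> (0 :: real^2)" by (simp add: axis_eq_0_iff)
    with True show ?thesis by (intro that[of "axis 1 1"]) auto
  next
    case False
    let ?t = "vector [a \<bullet> (B $ 2 *v b), - (a \<bullet> (B $ 1 *v b))] :: real^2"
    have "?t \<noteq> 0" using False by (simp add: vec_eq_iff forall_2)
    moreover have "a \<bullet> (comb B ?t *v b) = 0"
      by (simp add: comb_def mv_simps inner_diff_right inner_add_right)
    ultimately show ?thesis by (rule that)
  qed
  have Bb: "comb B t *v b = 0"
    using span_a[of t b] t(2) ab by auto
  have "transpose (comb B t) *v y = 0" for y
  proof -
    obtain k where k: "transpose (comb B t) *v y = k *\<^sub>R b" using span_b by blast
    have "(transpose (comb B t) *v y) \<bullet> b = 0"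
      using Bb by (simp add: inner_transpose_mult del: transpose_matrix_vector)
    then show ?thesis unfolding k using ab by simp
  qed
  then have "transpose (comb B t) = 0" unfolding matrix_eq_0_iff by blast
  then have "comb B t = 0" by (simp only: transpose_eq_0_iff)
  moreover have "p \<bullet> t = 0" using all P0 by blast
  ultimately show False
    using ind t(1) unfolding M_independent_iff inj_embM_iff by blast
qed

text \<open>The maps induced by an isomorphism on the quotient by the Heisenberg ideal (\<open>T\<close>), on that
  ideal modulo its centre (\<open>S\<close>) and on the centre (\<open>c\<close>).\<close>

lemma heis_iso_structure:
  fixes B B' :: "real^'n^'n^2"
  assumes iso: "heis_iso p B p' B' F" and ind: "M_independent p' B'"
  obtains T S c where "linear T" "inj T" "\<And>s. p \<bullet> s = p' \<bullet> T s"
    "linear S" "c \<noteq> 0" "\<And>v w. omega (S v) (S w) = c * omega v w"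
    "\<And>s w. S (act p B s w) = act p' B' (T s) (S w)"
proof -
  have lin: "linear F" and bij: "bij F" and hom: "\<And>u v. F (br p B u v) = br p' B' (F u) (F v)"
    using iso by (auto simp: heis_iso_def)
  have ideal: "fst (F (0, w, z)) = 0" for w z
    using heis_iso_preserves_ideal[OF iso ind, of "(0, w, z)"] by simp
  define T where "T s = fst (F (s, 0, 0))" for s
  define S where "S w = fst (snd (F (0, w, 0)))" for w
  define \<rho> where "\<rho> s = snd (F (s, 0, 0))" for s
  define \<sigma> where "\<sigma> w = snd (snd (F (0, w, 0)))" for w
  define c where "c = snd (snd (F (0, 0, 1)))"
  have F_T: "F (s, 0, 0) = (T s, \<rho> s)" for s
    by (simp add: T_def \<rho>_def)
  have F_S: "F (0, w, 0) = (0, S w, \<sigma> w)" for w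
    by (simp add: S_def \<sigma>_def prod_eq_iff ideal)
  have "linear T"
  proof (rule linearI)
    show "T (s + t) = T s + T t" for s t
      using linear_add[OF lin, of "(s, 0, 0)" "(t, 0, 0)"] by (simp add: T_def)
    show "T (k *\<^sub>R s) = k *\<^sub>R T s" for k s
      using linear_cmul[OF lin, of k "(s, 0, 0)"] by (simp add: T_def)
  qed
  have "linear S"
  proof (rule linearI)
    show "S (v + w) = S v + S w" for v w
      using linear_add[OF lin, of "(0, v, 0)" "(0, w, 0)"] by (simp add: S_def)
    show "S (k *\<^sub>R w) = k *\<^sub>R S w" for k w
      using linear_cmul[OF lin, of k "(0, w, 0)"] by (simp add: S_def)
  qed
  have "surj T"
    unfolding surj_def
  proof
    fix t :: "real^2"
    obtain s w z where "F (s, w, z) = (t, 0, 0)"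
      using bij by (metis bij_pointE prod_cases3)
    then have "T s = t"
      using linear_add[OF lin, of "(s, 0, 0)" "(0, w, z)"] ideal[of w z]
      by (auto simp: T_def prod_eq_iff)
    then show "\<exists>s. t = T s" by blast
  qed
  then have "inj T" using \<open>linear T\<close> by (simp add: linear_surjective_imp_injective)
  have F_omega: "omega v w *\<^sub>R F (0, 0, 1) = (0, 0, omega (S v) (S w))" for v w
  proof -
    have "omega v w *\<^sub>R F (0, 0, 1) = F (br p B (0, v, 0) (0, w, 0))"
      by (simp add: br_def flip: linear_cmul[OF lin])
    also have "\<dots> = (0, 0, omega (S v) (S w))"
      by (simp only: hom F_S) (simp add: br_def)
    finally show ?thesis .
  qed
  obtain v0 w0 :: "real^('n + 'n)" where "omega v0 w0 = 1" using omega_unit by blast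
  then have F_Z: "F (0, 0, 1) = (0, 0, c)"
    using F_omega[of v0 w0] by (simp add: c_def)
  have "c \<noteq> 0"
  proof
    assume "c = 0"
    then have "F (0, 0, 1) = F 0" by (simp only: F_Z linear_0[OF lin]) (simp add: zero_prod_def)
    then have "(0, 0, 1) = (0 :: 'n heis)" by (rule injD[OF bij_is_inj[OF bij]])
    then show False by (simp add: zero_prod_def)
  qed
  moreover have "omega (S v) (S w) = c * omega v w" for v w
    using F_omega[of v w] by (simp add: F_Z mult.commute)
  moreover have "p \<bullet> s = p' \<bullet> T s" for s
  proof -
    have "(p \<bullet> s) *\<^sub>R F (0, 0, 1) = F (br p B (s, 0, 0) (0, 0, 1))"
      by (simp add: br_def flip: linear_cmul[OF lin])
    also have "\<dots> = br p' B' (T s, \<rho> s) (0, 0, c)"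
      by (simp only: hom F_Z F_T)
    finally show ?thesis
      using \<open>c \<noteq> 0\<close> by (cases "\<rho> s") (simp add: br_def F_Z)
  qed
  moreover have "S (act p B s w) = act p' B' (T s) (S w)" for s w
  proof -
    have "F (0, act p B s w, 0) = F (br p B (s, 0, 0) (0, w, 0))"
      by (simp add: br_def)
    also have "\<dots> = br p' B' (T s, \<rho> s) (0, S w, \<sigma> w)"
      by (simp only: hom F_T F_S)
    finally show ?thesis
      by (cases "\<rho> s") (simp add: br_def S_def)
  qed
  ultimately show ?thesis
    using that \<open>linear T\<close> \<open>inj T\<close> \<open>linear S\<close> by blast
qed

section \<open>Isomorphisms in matrix form\<close>

lemma lie_isomorphic_iff:
  fixes B B' :: "real^'n^'n^2"
  assumes adm: "admissible p B" "admissible p' B'"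
  shows "lie_isomorphic (g_alg p B) (g_alg p' B') \<longleftrightarrow> (\<exists>F. heis_iso p B p' B' F)"
proof -
  have inj: "inj (emb p B)" "inj (emb p' B')"
    using adm by (auto simp: admissible_def inj_emb)
  have comm: "commutator (emb p B u) (emb p B v) = emb p B (br p B u v)"
    "commutator (emb p' B' u) (emb p' B' v) = emb p' B' (br p' B' u v)" for u v
    using adm by (auto simp: admissible_def commutator_emb)
  note lin = linear_emb[of p B] linear_emb[of p' B']
  show ?thesis
  proof
    assume "lie_isomorphic (g_alg p B) (g_alg p' B')"
    then obtain f where bij: "bij_betw f (range (emb p B)) (range (emb p' B'))"
      and f_add: "\<And>u v. f (emb p B u + emb p B v) = f (emb p B u) + f (emb p B v)"
      and f_scale: "\<And>k u. f (k *\<^sub>R emb p B u) = k *\<^sub>R f (emb p B u)"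
      and f_comm: "\<And>u v. f (commutator (emb p B u) (emb p B v))
          = commutator (f (emb p B u)) (f (emb p B v))"
      unfolding lie_isomorphic_def lie_isomorphism_def by (auto simp flip: range_emb)
    define F where "F = inv (emb p' B') \<circ> f \<circ> emb p B"
    have F: "emb p' B' (F u) = f (emb p B u)" for u
      unfolding F_def comp_apply
      by (rule f_inv_into_f) (use bij in \<open>auto simp: bij_betw_def\<close>)
    have "linear F"
    proof (rule linearI)
      show "F (u + v) = F u + F v" for u v
        by (rule injD[OF inj(2)]) (simp add: F linear_add[OF lin(1)] linear_add[OF lin(2)] f_add)
      show "F (k *\<^sub>R u) = k *\<^sub>R F u" for k u
        by (rule injD[OF inj(2)]) (simp add: F linear_cmul[OF lin(1)] linear_cmul[OF lin(2)] f_scale)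
    qed
    moreover have "bij F"
    proof -
      have "bij_betw (f \<circ> emb p B) UNIV (range (emb p' B'))"
        using inj(1) bij by (auto intro!: bij_betw_trans[of _ _ "range (emb p B)"]
            simp: bij_betw_def[of "emb p B"])
      moreover have "bij_betw (inv (emb p' B')) (range (emb p' B')) UNIV"
        using inj(2) by (simp add: inj_imp_bij_betw_inv)
      ultimately show ?thesis
        unfolding F_def by (auto simp: comp_assoc intro: bij_betw_trans)
    qed
    moreover have "F (br p B u v) = br p' B' (F u) (F v)" for u v
      by (rule injD[OF inj(2)]) (simp add: F f_comm flip: comm)
    ultimately show "\<exists>F. heis_iso p B p' B' F"
      unfolding heis_iso_def by blast
  next
    assume "\<exists>F. heis_iso p B p' B' F"
    then obtain F where F: "linear F" "bij F" "\<And>u v. F (br p B u v) = br p' B' (F u) (F v)"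
      by (auto simp: heis_iso_def)
    define f where "f = emb p' B' \<circ> F \<circ> inv (emb p B)"
    have f: "f (emb p B u) = emb p' B' (F u)" for u
      by (simp add: f_def inv_f_f inj)
    have "bij_betw f (range (emb p B)) (range (emb p' B'))"
    proof -
      have "bij_betw (inv (emb p B)) (range (emb p B)) UNIV"
        using inj(1) by (simp add: inj_imp_bij_betw_inv)
      moreover have "bij_betw (emb p' B' \<circ> F) UNIV (range (emb p' B'))"
        using inj(2) F(2) by (auto intro!: bij_betw_trans[of _ _ UNIV] simp: bij_betw_def[of "emb p' B'"])
      ultimately show ?thesis
        unfolding f_def by (auto intro: bij_betw_trans)
    qed
    then have "lie_isomorphism (g_alg p B) (g_alg p' B') f"
      unfolding lie_isomorphism_def range_emb[symmetric]
      by (auto simp: comm f F linear_add[OF F(1)] linear_cmul[OF F(1)] linear_add[OF lin(2)]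
          linear_cmul[OF lin(2)] simp flip: linear_add[OF lin(1)] linear_cmul[OF lin(1)])
    then show "lie_isomorphic (g_alg p B) (g_alg p' B')"
      unfolding lie_isomorphic_def by blast
  qed
qed

lemma mem_Sp_iff:
  fixes S :: "real^('n::finite + 'n)^('n + 'n)"
  shows "S \<in> Sp \<longleftrightarrow> (\<forall>v w. omega (S *v v) (S *v w) = omega v w)"
proof -
  have e: "omega (S *v v) (S *v w) = v \<bullet> ((transpose S ** J_mat ** S) *v w)" for v w
    unfolding omega_def matrix_vector_mul_assoc[symmetric]
    by (metis inner_commute inner_transpose_mult)
  show ?thesis
  proof
    assume "S \<in> Sp"
    then show "\<forall>v w. omega (S *v v) (S *v w) = omega v w"
      unfolding e by (simp add: Sp_def omega_def)
  next
    assume om: "\<forall>v w. omega (S *v v) (S *v w) = omega v w"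
    then have "v \<bullet> ((transpose S ** J_mat ** S) *v w) = v \<bullet> (J_mat *v w)" for v w
      using om by (simp only: e[symmetric] omega_def[symmetric])
    then have "(transpose S ** J_mat ** S) *v w = J_mat *v w" for w
      using vector_eq_ldot by blast
    then have "transpose S ** J_mat ** S = J_mat" by (simp add: matrix_eq)
    moreover have "inj ((*v) S)"
    proof (subst linear_injective_0[OF matrix_vector_mul_linear], intro allI impI)
      fix v assume "S *v v = 0"
      then have "omega v w = 0" for w
        by (metis om omega_linear(7))
      then show "v = 0" by (rule omega_nondegenerate)
    qed
    then have "invertible S"
      by (simp add: invertible_left_inverse matrix_left_invertible_injective)
    ultimately show "S \<in> Sp" by (simp add: Sp_def)
  qed
qed

lemma conjugate_iff:
  fixes S C C' :: "real^'m^'m"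
  assumes "invertible S"
  shows "C' = S ** C ** matrix_inv S \<longleftrightarrow> (\<forall>w. C' *v (S *v w) = S *v (C *v w))"
proof -
  have inv: "S ** matrix_inv S = mat 1" "matrix_inv S ** S = mat 1"
    using assms unfolding invertible_def matrix_inv_def by (metis (mono_tags, lifting) someI_ex)+
  have "C' = S ** C ** matrix_inv S \<longleftrightarrow> C' ** S = S ** C"
    by (metis inv matrix_mul_assoc matrix_mul_rid)
  also have "\<dots> \<longleftrightarrow> (\<forall>w. C' *v (S *v w) = S *v (C *v w))"
    by (simp add: matrix_eq matrix_vector_mul_assoc)
  finally show ?thesis .
qed

text \<open>A similitude that intertwines the operators can be replaced by a symplectic matrix that
  intertwines them.\<close>

lemma symplectic_of_similitude:
  fixes S :: "real^('n::finite + 'n) \<Rightarrow> real^('n + 'n)"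
  assumes S: "linear S" and c: "c \<noteq> 0" "\<And>v w. omega (S v) (S w) = c * omega v w"
    and act: "\<And>s w. S (act p B s w) = act p' B' (T s) (S w)"
  obtains S' where "S' \<in> Sp" "\<And>s w. S' *v act p B s w = act p' B' (T s) (S' *v w)"
proof -
  \<comment> \<open>\<open>diag(I, -I)\<close> has factor \<open>-1\<close> and commutes with the block diagonal operators, so it
    corrects a negative \<open>c\<close>.\<close>
  define K where "K w = (if c > 0 then w else join (xpart w) (- ypart w))" for w :: "real^('n + 'n)"
  have "M *v (- y) = - (M *v y)" for M :: "real^'n^'n" and y
    by (rule linear_neg[OF matrix_vector_mul_linear])
  then have K_act: "K (act p B s w) = act p B s (K w)" for s w
    by (simp add: K_def act_def parts_eq_iff del: transpose_matrix_vector)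
  have K_omega: "omega (K v) (K w) = sgn c * omega v w" for v w
    using c(1) by (simp add: K_def omega_parts)
  have K: "linear K"
    by (rule linearI) (simp_all add: K_def parts_eq_iff)
  define R where "R w = (1 / sqrt \<bar>c\<bar>) *\<^sub>R S (K w)" for w
  have "linear R"
    unfolding R_def using linear_compose[OF K S] by (simp add: linear_compose_scale_right comp_def)
  then have R: "matrix R *v w = R w" for w
    by (simp add: matrix_works)
  have "omega (R v) (R w) = omega v w" for v w
  proof -
    have "omega (R v) (R w) = c * (sgn c * omega v w) / (sqrt \<bar>c\<bar> * sqrt \<bar>c\<bar>)"
      by (simp add: R_def c(2) K_omega)
    also have "\<dots> = omega v w"
      using c(1) by (simp add: sgn_if)
    finally show ?thesis .
  qed
  then have "matrix R \<in> Sp"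
    by (simp add: mem_Sp_iff R)
  moreover have "matrix R *v act p B s w = act p' B' (T s) (matrix R *v w)" for s w
    by (simp add: R) (simp add: R_def K_act act)
  ultimately show ?thesis by (rule that)
qed

lemma act_basis:
  assumes "\<And>s. p' \<bullet> s = p \<bullet> T s \<and> comb B' s = comb B (T s)"
  shows "act p' B' s w = act p B (T s) w"
  by (simp add: act_def assms)

lemma act_intertwines_iff:
  fixes S :: "real^('n::finite + 'n)^('n + 'n)"
  shows "(\<forall>k. \<forall>w. C_mat p' B' k *v (S *v w) = S *v (C_mat p B k *v w)) \<longleftrightarrow>
    (\<forall>s w. act p' B' s (S *v w) = S *v act p B s w)"
proof -
  have "act p' B' s v = s $ 1 *\<^sub>R act p' B' (axis 1 1) v + s $ 2 *\<^sub>R act p' B' (axis 2 1) v"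
    for p' :: "real^2" and B' :: "real^'n^'n^2" and s v
    by (subst real2_eq_axes[of s]) simp
  note axes = this
  show ?thesis
    unfolding C_mat_mult_vec
  proof (intro iffI allI)
    fix s w
    assume "\<forall>k w. act p' B' (axis k 1) (S *v w) = S *v act p B (axis k 1) w"
    then show "act p' B' s (S *v w) = S *v act p B s w"
      by (simp only: axes[of p' B' s] axes[of p B s] mv_simps)
  qed simp
qed

section \<open>The isomorphism criterion\<close>

theorem corollary3p7:
  fixes p pt :: "real^2" and B Bt :: "real^'n^'n^2"
  assumes "admissible p B" and "admissible pt Bt"
    and "normalized p" and "normalized pt"
  shows "lie_isomorphic (g_alg p B) (g_alg pt Bt) \<longleftrightarrow>
    p = pt \<and>
    (\<exists>S\<in>Sp. \<exists>pt' Bt'. basis_of_V_M pt Bt pt' Bt' \<and>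
       (\<forall>k. C_mat pt' Bt' k = S ** C_mat p B k ** matrix_inv S))"
proof -
  have ind: "M_independent pt Bt" using assms(2) by (simp add: admissible_def)
  have conj: "(\<forall>k. C_mat pt' Bt' k = S ** C_mat p B k ** matrix_inv S) \<longleftrightarrow>
      (\<forall>s w. act pt' Bt' s (S *v w) = S *v act p B s w)" if "S \<in> Sp" for S pt' Bt'
    using that by (simp add: Sp_def conjugate_iff act_intertwines_iff)
  show ?thesis
  proof
    assume "lie_isomorphic (g_alg p B) (g_alg pt Bt)"
    then obtain F where "heis_iso p B pt Bt F"
      using lie_isomorphic_iff assms by blast
    from heis_iso_structure[OF this ind] obtain T S c where T: "linear T" "inj T"
      "\<And>s. p \<bullet> s = pt \<bullet> T s" and S: "linear S" "c \<noteq> 0"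
      "\<And>v w. omega (S v) (S w) = c * omega v w"
      "\<And>s w. S (act p B s w) = act pt Bt (T s) (S w)"
      by metis
    \<comment> \<open>A normalized weight is determined by whether it vanishes.\<close>
    have "p = 0 \<longleftrightarrow> pt = 0"
    proof -
      have "surj T" using T by (simp add: linear_injective_imp_surjective)
      then show ?thesis
        using T(3) by (metis inner_eq_zero_iff inner_zero_left surjD)
    qed
    then have "p = pt"
      using assms(3,4) by (auto simp: normalized_def vec_eq_iff forall_2)
    from symplectic_of_similitude[OF S] obtain S' where
      S': "S' \<in> Sp" "\<And>s w. S' *v act p B s w = act pt Bt (T s) (S' *v w)"
      by metis
    define Bt' where "Bt' = (\<chi> k. comb Bt (T (axis k 1)))"
    have T_axis: "T s = s $ 1 *\<^sub>R T (axis 1 1) + s $ 2 *\<^sub>R T (axis 2 1)" for s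
      by (subst real2_eq_axes[of s]) (simp add: linear_add[OF T(1)] linear_cmul[OF T(1)])
    have b: "p \<bullet> s = pt \<bullet> T s \<and> comb Bt' s = comb Bt (T s)" for s
      by (subst (2) T_axis) (simp add: T(3) Bt'_def comb_def[of "\<chi> k. _ k"])
    then have "basis_of_V_M pt Bt p Bt'"
      using basis_of_V_M_iff[OF ind] T(1,2) by blast
    moreover have "\<forall>s w. act p Bt' s (S' *v w) = S' *v act p B s w"
      using S'(2) act_basis[OF b] by simp
    ultimately show "p = pt \<and> (\<exists>S\<in>Sp. \<exists>pt' Bt'. basis_of_V_M pt Bt pt' Bt' \<and>
       (\<forall>k. C_mat pt' Bt' k = S ** C_mat p B k ** matrix_inv S))"
      using \<open>p = pt\<close> S'(1) conj by blast
  next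
    assume "p = pt \<and> (\<exists>S\<in>Sp. \<exists>pt' Bt'. basis_of_V_M pt Bt pt' Bt' \<and>
       (\<forall>k. C_mat pt' Bt' k = S ** C_mat p B k ** matrix_inv S))"
    then obtain S pt' Bt' where S: "S \<in> Sp" and bas: "basis_of_V_M pt Bt pt' Bt'"
      and act: "\<And>s w. act pt' Bt' s (S *v w) = S *v act p B s w"
      using conj by metis
    from bas obtain T where T: "linear T" "inj T"
      "\<And>s. pt' \<bullet> s = pt \<bullet> T s \<and> comb Bt' s = comb Bt (T s)"
      using basis_of_V_M_iff[OF ind] by blast
    have S_omega: "omega (S *v v) (S *v w) = omega v w" for v w
      using S by (simp add: mem_Sp_iff)
    \<comment> \<open>Conjugation by a symplectic matrix preserves the similitude factor.\<close>
    have p: "p \<bullet> s = pt \<bullet> T s" for s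
    proof -
      obtain v w :: "real^('n + 'n)" where vw: "omega v w = 1" using omega_unit by blast
      have "pt' \<bullet> s = pt' \<bullet> s * omega (S *v v) (S *v w)"
        by (simp add: S_omega vw)
      also have "\<dots> = omega (act pt' Bt' s (S *v v)) (S *v w) + omega (S *v v) (act pt' Bt' s (S *v w))"
        by (rule omega_act[symmetric])
      also have "\<dots> = omega (act p B s v) w + omega v (act p B s w)"
        by (simp add: act S_omega)
      also have "\<dots> = p \<bullet> s"
        by (simp add: omega_act vw)
      finally show ?thesis using T(3) by simp
    qed
    have act': "S *v act p B s w = act pt Bt (T s) (S *v w)" for s w
      using act act_basis[OF T(3)] by metis
    define F :: "'n heis \<Rightarrow> 'n heis" where "F = (\<lambda>(s, w, z). (T s, S *v w, z))"
    have linF: "linear F"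
      by (rule linearI)
        (auto simp: F_def linear_add[OF T(1)] linear_cmul[OF T(1)] mv_simps)
    moreover have "bij F"
    proof -
      have "inj ((*v) S)"
        using S by (metis (no_types, lifting) Sp_def mem_Collect_eq invertible_left_inverse
            matrix_left_invertible_injective)
      then have "inj F"
        using T(2) by (auto simp: F_def inj_def)
      then show ?thesis
        using linear_injective_imp_surjective[OF linF] by (simp add: bij_def)
    qed
    moreover have "F (br p B u v) = br pt Bt (F u) (F v)" for u v
      by (cases u; cases v) (simp add: F_def br_def linear_0[OF T(1)] mv_simps act' p S_omega)
    ultimately have "heis_iso p B pt Bt F" by (simp add: heis_iso_def)
    then show "lie_isomorphic (g_alg p B) (g_alg pt Bt)"
      using lie_isomorphic_iff assms by blast
  qed
qed

end
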